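(* Let $k:I\to\mathbb{R}^+$ be a smooth function on an interval $I$, and let $\nabla$ be a cl-connection on $\mathbb{R}^2$ determined by $(W,m,n)$. If $\gamma:I\to\mathbb{R}^2$ is a smooth curve parametrized by arc length whose geodesic curvature with respect to $\nabla$ is $k(s)>0$, then its Frenet curvature $\kappa$ satisfies $$2\kappa^2-2\langle W,N\rangle(m-n)\kappa+(m^2+n^2)\langle W,N\rangle^2-k(s)^2=0 .$$ In particular, $\kappa$ can be expressed as $$\kappa=\frac{\langle W,N\rangle(m-n)\pm\sqrt{2k(s)^2-\langle W,N\rangle^2(m+n)^2}}{2},$$ provided that $2k(s)^2\ge\langle W,N\rangle^2(m+n)^2$. Here $m,n$ are evaluated along $\gamma$.
   Context: $\langle\cdot,\cdot\rangle$ is the Euclidean metric on $\mathbb{R}^2$ and $\nabla^0$ its Levi-Civita connection. Let $W$ be a constant unit vector field on $\mathbb{R}^2$ and let $m,n:\mathbb{R}^2\to\mathbb{R}$ be smooth functions, not both identically zero. The canonical linear connection (cl-connection) determined by $(W,m,n)$ is $$\nabla_XY=\nabla^0_XY+m\langle W,Y\rangle X+n\langle X,Y\rangle W .$$ For a smooth curve $\gamma$ parametrized by arc length, $T=\gamma'=(\cos\theta,\sin\theta)$ is the unit tangent, $N=(-\sin\theta,\cos\theta)$ the unit normal, and $\kappa=\theta'$ the (signed) Frenet curvature, so $\nabla^0_TT=\kappa N$, $\nabla^0_TN=-\kappa T$. The geodesic curvature $\kappa_g\ge 0$ of $\gamma$ with respect to $\nabla$ is defined by $\kappa_g^2=(\kappa+n\langle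 W,N\rangle)^2+(m\langle W,N\rangle-\kappa)^2$, with $m,n$ evaluated along $\gamma$. *)

theory Defs
  imports "HOL-Analysis.Analysis"
begin

section \<open>Smooth maps\<close>

text \<open>
  The derivative is taken within \<open>S\<close>, so that intervals containing an end point are covered
  by one-sided derivatives. The notion is meaningful where derivatives within \<open>S\<close> are unique;
  it is used for \<open>S = UNIV\<close> and for nondegenerate real intervals only.
\<close>

primrec C_k_on ::
  "nat \<Rightarrow> 'a::real_normed_vector set \<Rightarrow> ('a \<Rightarrow> 'b::real_normed_vector) \<Rightarrow> bool" where
  "C_k_on 0 S f \<longleftrightarrow> continuous_on S f"
| "C_k_on (Suc k) S f \<longleftrightarrow>
     f differentiable_on S \<and> (\<forall>v. C_k_on k S (\<lambda>x. frechet_derivative f (at x within S) v))"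

definition smooth_on ::
  "'a::real_normed_vector set \<Rightarrow> ('a \<Rightarrow> 'b::real_normed_vector) \<Rightarrow> bool" where
  "smooth_on S f \<longleftrightarrow> (\<forall>k. C_k_on k S f)"

section \<open>Canonical linear connections on the plane\<close>

text \<open>The Levi-Civita connection of the Euclidean metric is the directional derivative.\<close>

definition flat_connection ::
  "(real^2 \<Rightarrow> real^2) \<Rightarrow> (real^2 \<Rightarrow> real^2) \<Rightarrow> real^2 \<Rightarrow> real^2" where
  "flat_connection X Y p = frechet_derivative Y (at p) (X p)"

text \<open>A constant vector field is represented by its value \<open>W\<close>.\<close>

definition cl_connection_of ::
  "real^2 \<Rightarrow> (real^2 \<Rightarrow> real) \<Rightarrow> (real^2 \<Rightarrow> real) \<Rightarrow>
   (real^2 \<Rightarrow> real^2) \<Rightarrow> (real^2 \<Rightarrow> real^2) \<Rightarrow> real^2 \<Rightarrow> real^2" where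
  "cl_connection_of W m n X Y p =
     flat_connection X Y p + (m p * (W \<bullet> Y p)) *\<^sub>R X p + (n p * (X p \<bullet> Y p)) *\<^sub>R W"

definition is_cl_connection ::
  "((real^2 \<Rightarrow> real^2) \<Rightarrow> (real^2 \<Rightarrow> real^2) \<Rightarrow> real^2 \<Rightarrow> real^2) \<Rightarrow>
   real^2 \<Rightarrow> (real^2 \<Rightarrow> real) \<Rightarrow> (real^2 \<Rightarrow> real) \<Rightarrow> bool" where
  "is_cl_connection D W m n \<longleftrightarrow>
     norm W = 1 \<and> smooth_on UNIV m \<and> smooth_on UNIV n \<and>
     \<not> ((\<forall>p. m p = 0) \<and> (\<forall>p. n p = 0)) \<and>
     D = cl_connection_of W m n"

section \<open>Frenet apparatus of a plane curve\<close>

definition unit_tangent :: "real set \<Rightarrow> (real \<Rightarrow> real^2) \<Rightarrow> real \<Rightarrow> real^2" where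
  "unit_tangent I \<gamma> s = vector_derivative \<gamma> (at s within I)"

definition arc_length_parametrized :: "real set \<Rightarrow> (real \<Rightarrow> real^2) \<Rightarrow> bool" where
  "arc_length_parametrized I \<gamma> \<longleftrightarrow> (\<forall>s\<in>I. norm (unit_tangent I \<gamma> s) = 1)"

text \<open>If \<open>T = (cos \<theta>, sin \<theta>)\<close>, this is \<open>(- sin \<theta>, cos \<theta>)\<close>.\<close>

definition unit_normal :: "real set \<Rightarrow> (real \<Rightarrow> real^2) \<Rightarrow> real \<Rightarrow> real^2" where
  "unit_normal I \<gamma> s = vector [- (unit_tangent I \<gamma> s $ 2), unit_tangent I \<gamma> s $ 1]"

definition tangent_angle :: "real set \<Rightarrow> (real \<Rightarrow> real^2) \<Rightarrow> (real \<Rightarrow> real) \<Rightarrow> bool" where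
  "tangent_angle I \<gamma> \<theta> \<longleftrightarrow>
     \<theta> differentiable_on I \<and> (\<forall>s\<in>I. unit_tangent I \<gamma> s = vector [cos (\<theta> s), sin (\<theta> s)])"

text \<open>
  The curvature is the derivative of the tangent angle. Below it is shown that a smooth curve
  parametrized by arc length has a tangent angle, and that the derivative does not depend on
  its choice.
\<close>

definition frenet_curvature :: "real set \<Rightarrow> (real \<Rightarrow> real^2) \<Rightarrow> real \<Rightarrow> real" where
  "frenet_curvature I \<gamma> s =
     vector_derivative (SOME \<theta>. tangent_angle I \<gamma> \<theta>) (at s within I)"

section \<open>Geodesic curvature with respect to a canonical linear connection\<close>

definition geodesic_curvature ::
  "real^2 \<Rightarrow> (real^2 \<Rightarrow> real) \<Rightarrow> (real^2 \<Rightarrow> real) \<Rightarrow> real set \<Rightarrow> (real \<Rightarrow> real^2) \<Rightarrow> real \<Rightarrow> real" where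
  "geodesic_curvature W m n I \<gamma> s =
     sqrt ((frenet_curvature I \<gamma> s + n (\<gamma> s) * (W \<bullet> unit_normal I \<gamma> s))\<^sup>2
         + (m (\<gamma> s) * (W \<bullet> unit_normal I \<gamma> s) - frenet_curvature I \<gamma> s)\<^sup>2)"

section \<open>Adequacy of the definitions\<close>

lemma inner_real2: "(x::real^2) \<bullet> y = x$1 * y$1 + x$2 * y$2"
  by (simp add: inner_vec_def sum_2)

text \<open>
  The geodesic curvature depends on the connection only, although different triples
  \<open>(W, m, n)\<close> may determine the same connection.
\<close>

lemma cl_connection_of_determines:
  assumes "cl_connection_of W m n = cl_connection_of W' m' n'"
  shows "m p *\<^sub>R W = m' p *\<^sub>R W'" and "n p *\<^sub>R W = n' p *\<^sub>R W'"
proof -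
  have eq: "(m p * (W \<bullet> w)) *\<^sub>R v + (n p * (v \<bullet> w)) *\<^sub>R W
      = (m' p * (W' \<bullet> w)) *\<^sub>R v + (n' p * (v \<bullet> w)) *\<^sub>R W'" for v w :: "real^2"
    using fun_cong[OF fun_cong[OF fun_cong[OF assms, of "\<lambda>_. v"], of "\<lambda>_. w"], of p]
    by (simp add: cl_connection_of_def flat_connection_def)
  have 1: "m p * W$1 = m' p * W'$1"
    using arg_cong[OF eq[where v="vector [0,1]" and w="vector [1,0]"], of "\<lambda>x. x$2"]
    by (simp add: inner_real2)
  have 2: "m p * W$2 = m' p * W'$2"
    using arg_cong[OF eq[where v="vector [1,0]" and w="vector [0,1]"], of "\<lambda>x. x$1"]
    by (simp add: inner_real2)
  show "m p *\<^sub>R W = m' p *\<^sub>R W'"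
    using 1 2 by (simp add: vec_eq_iff forall_2)
  show "n p *\<^sub>R W = n' p *\<^sub>R W'"
    using eq[where v="vector [1,0]" and w="vector [1,0]"] 1
    by (simp add: vec_eq_iff forall_2 inner_real2)
qed

lemma geodesic_curvature_well_defined:
  assumes "is_cl_connection D W m n" "is_cl_connection D W' m' n'"
  shows "geodesic_curvature W m n I \<gamma> s = geodesic_curvature W' m' n' I \<gamma> s"
proof -
  have eq: "cl_connection_of W m n = cl_connection_of W' m' n'"
    using assms by (simp add: is_cl_connection_def)
  have "(m p *\<^sub>R W) \<bullet> v = (m' p *\<^sub>R W') \<bullet> v" "(n p *\<^sub>R W) \<bullet> v = (n' p *\<^sub>R W') \<bullet> v" for p v
    using cl_connection_of_determines[OF eq] by simp_all
  then show ?thesis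
    by (simp add: geodesic_curvature_def)
qed

context
  fixes I :: "real set"
  assumes I: "is_interval I" "interior I \<noteq> {}"
begin

lemma at_within_interval_neq_bot:
  assumes "s \<in> I"
  shows "at s within I \<noteq> bot"
proof -
  have "I \<noteq> {x}" for x
    using I(2) by auto
  then have "s islimpt I"
    using connected_imp_perfect[of I s] I(1) assms by (auto simp: is_interval_connected)
  then show ?thesis
    by (simp add: trivial_limit_within)
qed

lemma tangent_angle_derivative:
  assumes "tangent_angle I \<gamma> \<theta>" "s \<in> I"
  shows "(unit_tangent I \<gamma> has_vector_derivative
           vector_derivative \<theta> (at s within I) *\<^sub>R unit_normal I \<gamma> s) (at s within I)"
proof -
  define d where "d = vector_derivative \<theta> (at s within I)"
  have T: "unit_tangent I \<gamma> t = vector [cos (\<theta> t), sin (\<theta> t)]" if "t \<in> I" for t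
    using assms(1) that by (simp add: tangent_angle_def)
  have "(\<theta> has_vector_derivative d) (at s within I)"
    using assms unfolding d_def tangent_angle_def differentiable_on_def
    by (simp add: vector_derivative_works)
  then have \<theta>: "(\<theta> has_real_derivative d) (at s within I)"
    by (simp add: has_real_derivative_iff_has_vector_derivative)
  have c: "((\<lambda>t. cos (\<theta> t)) has_vector_derivative (- sin (\<theta> s) * d)) (at s within I)"
    using \<theta> unfolding has_real_derivative_iff_has_vector_derivative[symmetric]
    by (auto intro!: derivative_eq_intros)
  have n: "((\<lambda>t. sin (\<theta> t)) has_vector_derivative (cos (\<theta> s) * d)) (at s within I)"
    using \<theta> unfolding has_real_derivative_iff_has_vector_derivative[symmetric]
    by (auto intro!: derivative_eq_intros)
  have e: "cos (\<theta> t) *\<^sub>R axis 1 1 + sin (\<theta> t) *\<^sub>R axis 2 1 = (vector [cos (\<theta> t), sin (\<theta> t)] :: real^2)" for t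
    by (simp add: vec_eq_iff forall_2 axis_def)
  have "((\<lambda>t. cos (\<theta> t) *\<^sub>R axis 1 1 + sin (\<theta> t) *\<^sub>R axis 2 1 :: real^2) has_vector_derivative
      (- sin (\<theta> s) * d) *\<^sub>R axis 1 1 + (cos (\<theta> s) * d) *\<^sub>R axis 2 1) (at s within I)"
    using has_vector_derivative_add[OF
        bounded_linear.has_vector_derivative[OF bounded_linear_scaleR_left c, of "axis 1 1 :: real^2"]
        bounded_linear.has_vector_derivative[OF bounded_linear_scaleR_left n, of "axis 2 1 :: real^2"]] .
  moreover have "(- sin (\<theta> s) * d) *\<^sub>R axis 1 1 + (cos (\<theta> s) * d) *\<^sub>R axis 2 1 = d *\<^sub>R unit_normal I \<gamma> s"
    using T[OF assms(2)] by (simp add: vec_eq_iff forall_2 axis_def unit_normal_def)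
  ultimately have "((\<lambda>t. vector [cos (\<theta> t), sin (\<theta> t)] :: real^2) has_vector_derivative
      d *\<^sub>R unit_normal I \<gamma> s) (at s within I)"
    by (simp only: e)
  then show ?thesis
    unfolding d_def[symmetric]
    by (rule has_vector_derivative_transform_within[where d=1]) (use T assms(2) in auto)
qed

lemma tangent_angle_exists:
  assumes "smooth_on I \<gamma>" "arc_length_parametrized I \<gamma>"
  shows "\<exists>\<theta>. tangent_angle I \<gamma> \<theta>"
proof -
  define T where "T = unit_tangent I \<gamma>"
  have C2: "C_k_on (Suc (Suc 0)) I \<gamma>"
    using assms(1) unfolding smooth_on_def by blast
  have "(\<lambda>x. frechet_derivative \<gamma> (at x within I) 1) differentiable_on I" and g: "\<gamma> differentiable_on I"
    using C2 by auto
  moreover have "frechet_derivative \<gamma> (at s within I) 1 = T s" if "s \<in> I" for s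
  proof -
    have "(\<gamma> has_derivative frechet_derivative \<gamma> (at s within I)) (at s within I)"
      using g that by (simp add: differentiable_on_def frechet_derivative_works)
    moreover from this have "frechet_derivative \<gamma> (at s within I)
        = (\<lambda>x. x *\<^sub>R frechet_derivative \<gamma> (at s within I) 1)"
      by (intro ext, subst linear_scale[OF has_derivative_linear, symmetric]) auto
    ultimately have "(\<gamma> has_vector_derivative frechet_derivative \<gamma> (at s within I) 1) (at s within I)"
      unfolding has_vector_derivative_def by simp
    then show ?thesis
      unfolding T_def unit_tangent_def
      using vector_derivative_within[OF at_within_interval_neq_bot[OF that]] by metis
  qed
  ultimately have Td: "T differentiable_on I"
    unfolding differentiable_on_def
    by (metis (no_types, lifting) differentiable_transform_within zero_less_one)
  define f where "f s = Complex (T s $ 1) (T s $ 2)" for s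
  have f_eq: "f = (\<lambda>v::real^2. v$1 *\<^sub>R 1 + v$2 *\<^sub>R \<i>) \<circ> T"
    by (auto simp: f_def complex_eq_iff)
  have bl: "bounded_linear (\<lambda>v::real^2. v$1 *\<^sub>R 1 + v$2 *\<^sub>R \<i>)"
    by (intro bounded_linear_add bounded_linear_scaleR_left[THEN bounded_linear_compose]
        bounded_linear_vec_nth)
  have f_deriv: "\<exists>f'. (f has_vector_derivative f') (at s within I)" if "s \<in> I" for s
  proof -
    have "(T has_vector_derivative vector_derivative T (at s within I)) (at s within I)"
      using Td that by (simp add: differentiable_on_def vector_derivative_works)
    from bounded_linear.has_vector_derivative[OF bl this] show ?thesis
      unfolding f_eq o_def by blast
  qed
  have norm_f: "norm (f s) = 1" if "s \<in> I" for s
  proof -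
    have "norm (T s) = 1"
      using assms(2) that by (simp add: arc_length_parametrized_def T_def)
    then show ?thesis
      by (simp add: f_def cmod_def norm_eq_sqrt_inner inner_real2 power2_eq_square)
  qed
  have "continuous_on I f"
    using f_deriv by (meson continuous_on_eq_continuous_within has_vector_derivative_continuous)
  moreover have "contractible I"
    using I(1) by (simp add: convex_imp_contractible is_interval_convex)
  moreover have "f s \<noteq> 0" if "s \<in> I" for s
    using norm_f[OF that] by auto
  ultimately obtain g where g: "continuous_on I g" "\<And>s. s \<in> I \<Longrightarrow> f s = exp (g s)"
    using continuous_logarithm_on_contractible[of I f] by metis
  have Re_g: "Re (g s) = 0" if "s \<in> I" for s
    using norm_f[OF that] g(2)[OF that] by simp
  define \<theta> where "\<theta> s = Im (g s)" for s
  have "\<exists>d. (\<theta> has_vector_derivative d) (at s within I)" if s: "s \<in> I" for s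
  proof -
    obtain f' where f': "(f has_vector_derivative f') (at s within I)"
      using f_deriv[OF s] by blast
    have fs: "f s \<noteq> 0"
      using norm_f[OF s] by auto
    have "((\<lambda>z. Ln (z / f s)) has_field_derivative (1 / f s)) (at (f s) within f ` I)"
      using fs by (auto intro!: derivative_eq_intros simp: complex_nonpos_Reals_iff)
    from field_vector_diff_chain_within[OF f' this]
    have "((\<lambda>t. Ln (f t / f s)) has_vector_derivative (f' * (1 / f s))) (at s within I)"
      by (simp add: o_def)
    from bounded_linear.has_vector_derivative[OF bounded_linear_Im this]
    have L: "((\<lambda>t. Im (Ln (f t / f s)) + \<theta> s) has_vector_derivative Im (f' * (1 / f s))) (at s within I)"
      by (simp add: has_vector_derivative_add_const)
    obtain e where e: "e > 0" "\<And>t. t \<in> I \<Longrightarrow> dist t s < e \<Longrightarrow> dist (g t) (g s) < 1"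
      using g(1) s unfolding continuous_on_iff by (metis zero_less_one)
    have "(\<theta> has_vector_derivative Im (f' * (1 / f s))) (at s within I)"
    proof (rule has_vector_derivative_transform_within[OF L e(1) s])
      fix t assume t: "t \<in> I" "dist t s < e"
      have "\<bar>Im (g t - g s)\<bar> < 1"
        using e(2)[OF t] abs_Im_le_cmod[of "g t - g s"] by (simp add: dist_norm)
      then have "Ln (exp (g t - g s)) = g t - g s"
        using pi_gt3 by (intro Ln_exp) auto
      then show "Im (Ln (f t / f s)) + \<theta> s = \<theta> t"
        using g(2)[OF s] g(2)[OF t(1)] by (simp add: exp_diff \<theta>_def)
    qed
    then show ?thesis ..
  qed
  then have "\<theta> differentiable_on I"
    by (meson differentiable_on_def differentiableI_vector)
  moreover have "unit_tangent I \<gamma> s = vector [cos (\<theta> s), sin (\<theta> s)]" if "s \<in> I" for s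
  proof -
    have "Re (f s) = cos (\<theta> s)" "Im (f s) = sin (\<theta> s)"
      using g(2)[OF that] Re_g[OF that] by (simp_all add: \<theta>_def Re_exp Im_exp)
    then show ?thesis
      by (simp add: vec_eq_iff forall_2 f_def T_def)
  qed
  ultimately show ?thesis
    unfolding tangent_angle_def by blast
qed

lemma frenet_curvature_eq:
  assumes "tangent_angle I \<gamma> \<theta>" "s \<in> I"
  shows "frenet_curvature I \<gamma> s = vector_derivative \<theta> (at s within I)"
proof -
  define \<theta>' where "\<theta>' = (SOME \<theta>. tangent_angle I \<gamma> \<theta>)"
  have ta: "tangent_angle I \<gamma> \<theta>'"
    unfolding \<theta>'_def by (rule someI[of "tangent_angle I \<gamma>", OF assms(1)])
  have "vector_derivative \<theta>' (at s within I) *\<^sub>R unit_normal I \<gamma> s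
      = vector_derivative \<theta> (at s within I) *\<^sub>R unit_normal I \<gamma> s"
    using tangent_angle_derivative[OF ta assms(2)] tangent_angle_derivative[OF assms]
      vector_derivative_within[OF at_within_interval_neq_bot[OF assms(2)]] by metis
  moreover have "unit_normal I \<gamma> s \<noteq> 0"
  proof
    assume "unit_normal I \<gamma> s = 0"
    then have "sin (\<theta> s) = 0" "cos (\<theta> s) = 0"
      using assms by (auto simp: tangent_angle_def unit_normal_def vec_eq_iff forall_2)
    then show False
      using sin_cos_squared_add[of "\<theta> s"] by simp
  qed
  ultimately show ?thesis
    unfolding frenet_curvature_def \<theta>'_def[symmetric] by simp
qed

lemma frenet_equation:
  assumes "smooth_on I \<gamma>" "arc_length_parametrized I \<gamma>" "s \<in> I"
  shows "(unit_tangent I \<gamma> has_vector_derivative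
           frenet_curvature I \<gamma> s *\<^sub>R unit_normal I \<gamma> s) (at s within I)"
  using tangent_angle_exists[OF assms(1,2)] tangent_angle_derivative frenet_curvature_eq assms(3)
  by metis

end

end

theory Submission
  imports Defs
begin

text \<open>
  The theorem is pointwise algebra. With \<open>w = W \<bullet> N\<close> at a fixed parameter, the geodesic
  curvature makes \<open>k\<^sup>2\<close> the sum of the squares of \<open>\<kappa> + n w\<close> and \<open>m w - \<kappa>\<close>, and expanding it
  gives the quadratic equation for \<open>\<kappa>\<close>. The parallelogram law rewrites twice that sum as the
  square of the sum, \<open>w (m + n)\<close>, plus the square of the difference, \<open>2 \<kappa> - w (m - n)\<close>.
  Since \<open>\<kappa>\<close> has cancelled from the first of these, \<open>\<kappa>\<close> is found by taking a square root.
\<close>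

text \<open>
  The radicand is the square of \<open>2 \<kappa> - w (m - n)\<close>, so its root is the absolute value of that
  expression, and the two signs of the formula are the two signs of that expression.
\<close>

lemma sum_of_squares_solve:
  fixes \<kappa> w m n k :: real
  assumes k: "k\<^sup>2 = (\<kappa> + n * w)\<^sup>2 + (m * w - \<kappa>)\<^sup>2"
  defines "r \<equiv> sqrt (2 * k\<^sup>2 - w\<^sup>2 * (m + n)\<^sup>2)"
  shows "\<kappa> = (w * (m - n) + r) / 2 \<or> \<kappa> = (w * (m - n) - r) / 2"
proof -
  have "2 * k\<^sup>2 - w\<^sup>2 * (m + n)\<^sup>2 = (2 * \<kappa> - w * (m - n))\<^sup>2"
    unfolding k by algebra
  then have "r = \<bar>2 * \<kappa> - w * (m - n)\<bar>"
    by (simp add: r_def)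
  then show ?thesis
    by (auto simp: abs_if)
qed

theorem theorem4p3:
  fixes I :: "real set" and k :: "real \<Rightarrow> real"
    and nabla :: "(real^2 \<Rightarrow> real^2) \<Rightarrow> (real^2 \<Rightarrow> real^2) \<Rightarrow> real^2 \<Rightarrow> real^2"
    and W :: "real^2" and m n :: "real^2 \<Rightarrow> real"
    and \<gamma> :: "real \<Rightarrow> real^2"
  assumes "is_interval I" and "interior I \<noteq> {}"
    and "smooth_on I k" and "\<forall>s\<in>I. k s > 0"
    and "is_cl_connection nabla W m n"
    and "smooth_on I \<gamma>" and "arc_length_parametrized I \<gamma>"
    and "\<forall>s\<in>I. geodesic_curvature W m n I \<gamma> s = k s"
  shows "\<forall>s\<in>I.
    (let \<kappa> = frenet_curvature I \<gamma> s; w = W \<bullet> unit_normal I \<gamma> s; m' = m (\<gamma> s); n' = n (\<gamma> s)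
     in 2 * \<kappa>\<^sup>2 - 2 * w * (m' - n') * \<kappa> + (m'\<^sup>2 + n'\<^sup>2) * w\<^sup>2 - (k s)\<^sup>2 = 0 \<and>
        (2 * (k s)\<^sup>2 \<ge> w\<^sup>2 * (m' + n')\<^sup>2 \<longrightarrow>
          \<kappa> = (w * (m' - n') + sqrt (2 * (k s)\<^sup>2 - w\<^sup>2 * (m' + n')\<^sup>2)) / 2 \<or>
          \<kappa> = (w * (m' - n') - sqrt (2 * (k s)\<^sup>2 - w\<^sup>2 * (m' + n')\<^sup>2)) / 2))"
proof
  fix s
  assume "s \<in> I"
  define \<kappa> where "\<kappa> = frenet_curvature I \<gamma> s"
  define w where "w = W \<bullet> unit_normal I \<gamma> s"
  have "k s = sqrt ((\<kappa> + n (\<gamma> s) * w)\<^sup>2 + (m (\<gamma> s) * w - \<kappa>)\<^sup>2)"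
    using assms(8) \<open>s \<in> I\<close> by (simp add: geodesic_curvature_def \<kappa>_def w_def)
  then have k: "(k s)\<^sup>2 = (\<kappa> + n (\<gamma> s) * w)\<^sup>2 + (m (\<gamma> s) * w - \<kappa>)\<^sup>2"
    by simp
  have "2 * \<kappa>\<^sup>2 - 2 * w * (m (\<gamma> s) - n (\<gamma> s)) * \<kappa> + ((m (\<gamma> s))\<^sup>2 + (n (\<gamma> s))\<^sup>2) * w\<^sup>2 - (k s)\<^sup>2 = 0"
    unfolding k by algebra
  with sum_of_squares_solve[OF k]
  show "let \<kappa> = frenet_curvature I \<gamma> s; w = W \<bullet> unit_normal I \<gamma> s; m' = m (\<gamma> s); n' = n (\<gamma> s)
     in 2 * \<kappa>\<^sup>2 - 2 * w * (m' - n') * \<kappa> + (m'\<^sup>2 + n'\<^sup>2) * w\<^sup>2 - (k s)\<^sup>2 = 0 \<and>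
        (2 * (k s)\<^sup>2 \<ge> w\<^sup>2 * (m' + n')\<^sup>2 \<longrightarrow>
          \<kappa> = (w * (m' - n') + sqrt (2 * (k s)\<^sup>2 - w\<^sup>2 * (m' + n')\<^sup>2)) / 2 \<or>
          \<kappa> = (w * (m' - n') - sqrt (2 * (k s)\<^sup>2 - w\<^sup>2 * (m' + n')\<^sup>2)) / 2)"
    unfolding Let_def \<kappa>_def w_def by blast
qed

end
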